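(* Assume the Continuum Hypothesis and the Axiom of Choice. Then (a) every subset of $\mathbb{R}$ is an $F_\sigma$ set in the topology $\tau_{\mathbb{Q}}$; (b) every subset of $\mathbb{R}$ is an $F_\sigma$ set in the topology $\tau_{\mathcal{H}}$.
   Context: The axioms named are assumed in addition to ZF. A set is $F_\sigma$ in a topology if it is a countable union of closed sets of that topology. The topology $\tau_{\mathbb{Q}}$ on $\mathbb{R}$: a set $U\subseteq\mathbb{R}$ is $\tau_{\mathbb{Q}}$-open iff for every $a\in U$ and every real $x\neq0$ there is $\varepsilon(a,x)>0$ such that $a+qx\in U$ for all $q\in\mathbb{Q}$ with $0<q<\varepsilon(a,x)$. A function $H:\mathbb{R}\to\mathbb{R}$ is additive if $H(x+y)=H(x)+H(y)$ for all $x,y$. $\tau_{\mathcal{H}}$ is the initial topology on $\mathbb{R}$ generated by all additive functions, i.e. the smallest topology making every additive $H$ continuous as a map from $(\mathbb{R},\tau_{\mathcal{H}})$ to $\mathbb{R}$ with the usual topology. *)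

theory Defs
  imports "HOL-Analysis.Analysis"
begin

definition continuum_hypothesis :: bool where
  "continuum_hypothesis \<longleftrightarrow>
    \<not> (\<exists>S :: real set. (UNIV :: nat set) \<prec> S \<and> S \<prec> (UNIV :: real set))"

definition tau_Q_open :: "real set \<Rightarrow> bool" where
  "tau_Q_open U \<longleftrightarrow>
    (\<forall>a\<in>U. \<forall>x. x \<noteq> 0 \<longrightarrow>
      (\<exists>\<epsilon>>0. \<forall>q\<in>\<rat>. 0 < q \<and> q < \<epsilon> \<longrightarrow> a + q * x \<in> U))"

definition tau_Q :: "real topology" where
  "tau_Q = topology tau_Q_open"

lemma istopology_tau_Q_open: "istopology tau_Q_open"
  unfolding istopology_def
proof (intro conjI allI impI)
  fix S T assume S: "tau_Q_open S" and T: "tau_Q_open T"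
  show "tau_Q_open (S \<inter> T)"
    unfolding tau_Q_open_def
  proof (intro ballI allI impI)
    fix a x :: real assume a: "a \<in> S \<inter> T" and x: "x \<noteq> 0"
    obtain d where d: "d > 0" "\<forall>q\<in>\<rat>. 0 < q \<and> q < d \<longrightarrow> a + q * x \<in> S"
      using S a x unfolding tau_Q_open_def by blast
    obtain e where e: "e > 0" "\<forall>q\<in>\<rat>. 0 < q \<and> q < e \<longrightarrow> a + q * x \<in> T"
      using T a x unfolding tau_Q_open_def by blast
    show "\<exists>\<epsilon>>0. \<forall>q\<in>\<rat>. 0 < q \<and> q < \<epsilon> \<longrightarrow> a + q * x \<in> S \<inter> T"
      using d e by (intro exI[of _ "min d e"]) auto
  qed
next
  fix \<K> assume K: "\<forall>K\<in>\<K>. tau_Q_open K"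
  show "tau_Q_open (\<Union>\<K>)"
    unfolding tau_Q_open_def
  proof (intro ballI allI impI)
    fix a x :: real assume a: "a \<in> \<Union>\<K>" and x: "x \<noteq> 0"
    then obtain K where "K \<in> \<K>" "a \<in> K" by blast
    moreover from this K x obtain e
      where "e > 0" "\<forall>q\<in>\<rat>. 0 < q \<and> q < e \<longrightarrow> a + q * x \<in> K"
      unfolding tau_Q_open_def by blast
    ultimately show "\<exists>\<epsilon>>0. \<forall>q\<in>\<rat>. 0 < q \<and> q < \<epsilon> \<longrightarrow> a + q * x \<in> \<Union>\<K>"
      by blast
  qed
qed

lemma openin_tau_Q: "openin tau_Q U \<longleftrightarrow> tau_Q_open U"
  by (simp add: tau_Q_def istopology_tau_Q_open)

lemma topspace_tau_Q [simp]: "topspace tau_Q = UNIV"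
proof -
  have "openin tau_Q UNIV"
    unfolding openin_tau_Q tau_Q_open_def by (auto intro: exI[of _ 1])
  then show ?thesis
    using openin_subset by fastforce
qed

text \<open>The qualified name is needed: the Analysis library has a second, measure-theoretic
  constant called additive.\<close>

definition tau_H :: "real topology" where
  "tau_H = topology_generated_by
    {H -` V | (H :: real \<Rightarrow> real) V. Modules.additive H \<and> open V}"

lemma topspace_tau_H [simp]: "topspace tau_H = UNIV"
proof -
  have "Modules.additive (\<lambda>x::real. x)"
    by (simp add: Modules.additive_def)
  then have "openin tau_H ((\<lambda>x::real. x) -` UNIV)"
    unfolding tau_H_def by (intro topology_generated_by_Basis) blast
  then show ?thesis
    using openin_subset by fastforce
qed

lemma continuous_map_tau_H:
  assumes "Modules.additive (H :: real \<Rightarrow> real)"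
  shows "continuous_map tau_H euclidean H"
proof -
  have "openin tau_H (H -` V)" if "open V" for V
    unfolding tau_H_def using assms that by (intro topology_generated_by_Basis) blast
  then show ?thesis
    by (simp add: continuous_map_def vimage_def)
qed

lemma tau_H_smallest:
  assumes "topspace X = UNIV"
    and cont: "\<And>H :: real \<Rightarrow> real. Modules.additive H \<Longrightarrow> continuous_map X euclidean H"
    and "openin tau_H U"
  shows "openin X U"
proof -
  have basis: "openin X W"
    if "W \<in> {H -` V | (H :: real \<Rightarrow> real) V. Modules.additive H \<and> open V}" for W
    using that cont assms(1) by (fastforce simp: continuous_map_def vimage_def)
  have "generate_topology_on {H -` V | (H :: real \<Rightarrow> real) V. Modules.additive H \<and> open V} U"
    using assms(3) by (simp add: tau_H_def openin_topology_generated_by_iff)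
  then show ?thesis
    by (induction rule: generate_topology_on.induct) (auto intro: basis)
qed

end

theory Submission
  imports Defs
begin

text \<open>
  The weaker topology \<^const>\<open>tau_H\<close> is the one to work with: it is contained in
  \<^const>\<open>tau_Q\<close>, because \<open>H (a + q * x) = H a + q * H x\<close> for additive \<open>H\<close> and rational \<open>q\<close>.

  Regard the reals as a vector space over the rationals; the linear functionals to the reals are
  additive. They separate a linearly independent set \<open>D\<close> so well that \<open>D\<close> and all its subsets are
  closed (\<open>closedin_tau_H_subset_independent\<close>): a point \<open>p \<noteq> 0\<close> lies outside the span of \<open>D - {d}\<close>
  for some \<open>d\<close>, and a functional that is \<open>1\<close> at \<open>p\<close> and \<open>0\<close> on \<open>D - {d}\<close> gives a neighbourhood
  of \<open>p\<close> that meets \<open>D\<close> at most in \<open>d\<close>; if \<open>d \<noteq> p\<close>, the closed point \<open>d\<close> can be removed from it,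
  and \<open>0\<close> is separated from \<open>D\<close> by a functional that is \<open>1\<close> on \<open>D\<close>. So it is
  enough to write the nonzero reals as a countable union \<open>\<Union>n. D n\<close> of linearly independent sets,
  since then an arbitrary \<open>A\<close> is the union of the closed sets \<open>A \<inter> {0}\<close> and \<open>A \<inter> D n\<close>.

  Under the continuum hypothesis such a decomposition exists; this is a theorem of Erdos and
  Kakutani (\<open>erdos_kakutani\<close>). Well-order the reals so that all initial segments are countable. A
  nonzero real has a level: the first \<open>a\<close> whose predecessors, together with \<open>a\<close>, span it. Every level
  consists of countably many reals, and reals of pairwise different levels are linearly
  independent, since the one of highest level is not spanned by the others. Hence it suffices to
  enumerate every level and to let \<open>D n\<close> collect the \<open>n\<close>-th element of each.
\<close>

section \<open>The reals as a rational vector space\<close>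

interpretation rat_real: vector_space "\<lambda>q x. real_of_rat q * x"
  by unfold_locales (simp_all add: algebra_simps of_rat_add of_rat_mult)

interpretation rat_real_pair:
  vector_space_pair "\<lambda>q x. real_of_rat q * x" "\<lambda>q x. real_of_rat q * x"
  by unfold_locales

lemma countable_rat_span:
  assumes "countable S"
  shows "countable (rat_real.span S)"
proof -
  let ?f = "\<lambda>l. sum_list (map (\<lambda>(q, x). real_of_rat q * x) l)"
  have "y \<in> ?f ` lists (UNIV \<times> S)" if "y \<in> rat_real.span S" for y
    using that
  proof (induction rule: rat_real.span_induct_alt)
    case base
    show ?case by (intro image_eqI[of _ _ "[]"]) auto
  next
    case (step c x y)
    then obtain l where "l \<in> lists (UNIV \<times> S)" "y = ?f l" by blast
    with step show ?case by (intro image_eqI[of _ _ "(c, x) # l"]) auto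
  qed
  then have "rat_real.span S \<subseteq> ?f ` lists (UNIV \<times> S)" by blast
  moreover have "countable (?f ` lists ((UNIV :: rat set) \<times> S))"
    using assms by (intro countable_image countable_lists countable_SIGMA) auto
  ultimately show ?thesis by (rule countable_subset)
qed

lemma rat_span_finite_support:
  assumes "x \<in> rat_real.span S"
  obtains T where "finite T" "T \<subseteq> S" "x \<in> rat_real.span T"
proof -
  obtain t c where "finite t" "t \<subseteq> S" "x = (\<Sum>a\<in>t. real_of_rat (c a) * a)"
    using assms unfolding rat_real.span_explicit by blast
  then show ?thesis
    by (intro that[of t]) (auto intro: rat_real.span_sum rat_real.span_scale rat_real.span_base)
qed

text \<open>The \<open>d\<close> to remove is any vector that occurs in the expansion of \<open>p\<close>; it is found as an
  element of a spanning subset of least cardinality, which contains no superfluous vector. If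
  \<open>p\<close> is not in the span of \<open>D\<close> at all, every \<open>d\<close> will do.\<close>

lemma independent_remove_notin_span:
  assumes ind: "rat_real.independent D" and "p \<noteq> 0"
  obtains d where "p \<notin> rat_real.span (D - {d})"
proof (cases "p \<in> rat_real.span D")
  case False
  then have "p \<notin> rat_real.span (D - {0})"
    using rat_real.span_mono[of "D - {0}" D] by blast
  then show ?thesis by (rule that)
next
  case True
  let ?P = "\<lambda>T. finite T \<and> T \<subseteq> D \<and> p \<in> rat_real.span T"
  obtain T0 where "?P T0" using rat_span_finite_support[OF True] by metis
  from ex_has_least_nat[of ?P, OF this, of card]
  obtain T where T: "?P T" and min: "\<And>T'. ?P T' \<Longrightarrow> card T \<le> card T'"
    by meson
  have "T \<noteq> {}" using T \<open>p \<noteq> 0\<close> by auto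
  then obtain d where d: "d \<in> T" by blast
  have "card (T - {d}) < card T" using T d by (intro psubset_card_mono) auto
  then have notin: "p \<notin> rat_real.span (T - {d})"
    using min[of "T - {d}"] T by (meson finite_Diff linorder_not_le subset_trans Diff_subset)
  have "p \<in> rat_real.span (insert d (T - {d}))" using T d by (simp add: insert_absorb)
  from rat_real.in_span_insert[OF this notin]
  have d_span: "d \<in> rat_real.span (insert p (T - {d}))" .
  have "p \<notin> rat_real.span (D - {d})"
  proof
    assume "p \<in> rat_real.span (D - {d})"
    then have "insert p (T - {d}) \<subseteq> rat_real.span (D - {d})"
      using T by (auto intro: rat_real.span_base)
    then have "d \<in> rat_real.span (D - {d})"
      using d_span rat_real.span_minimal[OF _ rat_real.subspace_span] by blast
    with ind d T show False by (auto simp: rat_real.dependent_def)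
  qed
  then show ?thesis by (rule that)
qed

section \<open>Decomposition into countably many independent sets\<close>

lemma finite_has_greatest:
  assumes "Linear_order r" "finite F" "F \<noteq> {}" "F \<subseteq> Field r"
  obtains m where "m \<in> F" "F \<subseteq> under r m"
proof -
  have "\<exists>m\<in>F. \<forall>x\<in>F. (x, m) \<in> r"
    using assms(2,3,4)
  proof (induction rule: finite_ne_induct)
    case (singleton x)
    then show ?case using assms(1)
      by (auto simp: order_on_defs refl_on_def)
  next
    case (insert x F)
    then obtain m where m: "m \<in> F" "\<forall>y\<in>F. (y, m) \<in> r" by auto
    have xr: "(x, x) \<in> r" "(x, m) \<in> r \<or> (m, x) \<in> r"
      using insert m(1) assms(1) by (auto simp: order_on_defs refl_on_def total_on_def)
    have tr: "trans r" using assms(1) by (simp add: order_on_defs)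
    show ?case
    proof (cases "(x, m) \<in> r")
      case True
      then show ?thesis using m by blast
    next
      case False
      then have "\<forall>y\<in>F. (y, x) \<in> r" using xr(2) m(2) by (blast intro: transD[OF tr])
      then show ?thesis using xr by blast
    qed
  qed
  then show ?thesis using that by (auto simp: under_def)
qed

text \<open>The level of a nonzero real is the least \<open>a\<close> with \<open>x\<close> in the span of the reals up to
  \<open>a\<close>. Those strictly below \<open>a\<close> do not span \<open>x\<close>: finitely many vectors strictly below \<open>a\<close> that span \<open>x\<close> would have a greatest
  element, and this element would contradict the choice of \<open>a\<close>.\<close>

lemma level_exists:
  fixes r :: "real rel"
  assumes wo: "Well_order r" and F: "Field r = UNIV" and "x \<noteq> 0"
  shows "\<exists>a. x \<in> rat_real.span (under r a) \<and> x \<notin> rat_real.span (underS r a)"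
proof -
  have lin: "Linear_order r" and wfr: "wf (r - Id)"
    using wo by (simp_all add: well_order_on_def)
  have "x \<in> under r x"
    using lin F by (auto simp: order_on_defs refl_on_def under_def)
  then have "x \<in> rat_real.span (under r x)" by (rule rat_real.span_base)
  then obtain a where a: "x \<in> rat_real.span (under r a)"
    and least: "\<And>b. (b, a) \<in> r - Id \<Longrightarrow> x \<notin> rat_real.span (under r b)"
    using wfE_min[OF wfr, of x "{a. x \<in> rat_real.span (under r a)}"] by auto
  have "x \<notin> rat_real.span (underS r a)"
  proof
    assume "x \<in> rat_real.span (underS r a)"
    then obtain T where T: "finite T" "T \<subseteq> underS r a" "x \<in> rat_real.span T"
      by (rule rat_span_finite_support)
    then have "T \<noteq> {}" using \<open>x \<noteq> 0\<close> by auto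
    then obtain m where m: "m \<in> T" "T \<subseteq> under r m"
      using finite_has_greatest[OF lin T(1)] F by auto
    then have "x \<in> rat_real.span (under r m)"
      using T(3) rat_real.span_mono by blast
    moreover have "(m, a) \<in> r - Id" using m(1) T(2) by (auto simp: underS_def)
    ultimately show False using least by blast
  qed
  with a show ?thesis by blast
qed

text \<open>The vector of highest level in a finite set is not spanned by the others, which makes finite
  sets independent by induction on their size; a dependence only involves a finite set.\<close>

lemma independent_if_distinct_levels:
  fixes r :: "real rel"
  assumes wo: "Well_order r" and F: "Field r = UNIV"
    and inj: "inj_on level D"
    and level: "\<And>x. x \<in> D \<Longrightarrow> x \<in> rat_real.span (under r (level x))
                                  \<and> x \<notin> rat_real.span (underS r (level x))"
  shows "rat_real.independent D"
proof -
  have lin: "Linear_order r" using wo by (simp add: well_order_on_def)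
  have fin: "rat_real.independent T" if "finite T" "T \<subseteq> D" for T
    using that
  proof (induction "card T" arbitrary: T)
    case 0
    then show ?case by (simp add: rat_real.independent_empty)
  next
    case (Suc n)
    then have "level ` T \<noteq> {}" by auto
    then obtain a where a: "a \<in> level ` T" "level ` T \<subseteq> under r a"
      using finite_has_greatest[OF lin, of "level ` T"] Suc.prems F by auto
    then obtain t where t: "t \<in> T" and at: "a = level t" by blast
    have "y \<in> rat_real.span (underS r a)" if "y \<in> T - {t}" for y
    proof -
      have "level y \<noteq> a" using that inj Suc.prems t at by (auto simp: inj_on_def)
      moreover have "(level y, a) \<in> r" using a(2) that by (auto simp: under_def)
      moreover have "trans r" "antisym r" using lin by (simp_all add: order_on_defs)
      ultimately have "under r (level y) \<subseteq> underS r a"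
        unfolding under_def underS_def by (blast dest: transD antisymD)
      then show ?thesis
        using level[of y] that Suc.prems rat_real.span_mono by blast
    qed
    then have "rat_real.span (T - {t}) \<subseteq> rat_real.span (underS r a)"
      by (intro rat_real.span_minimal rat_real.subspace_span subsetI)
    then have "t \<notin> rat_real.span (T - {t})" using level[of t] t at Suc.prems by blast
    moreover have "rat_real.independent (T - {t})"
      using Suc.hyps(2) Suc.prems t by (intro Suc.hyps(1)) auto
    ultimately have "rat_real.independent (insert t (T - {t}))"
      by (rule rat_real.independent_insertI)
    then show ?case using t by (simp add: insert_absorb)
  qed
  show ?thesis
    unfolding rat_real.independent_explicit_module
    using rat_real.independentD[OF fin] by blast
qed

text \<open>A well-order of least possible length works: its proper initial segments have smaller
  cardinality than the reals, and the continuum hypothesis leaves only the countable ones.\<close>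

lemma continuum_hypothesis_well_order:
  assumes "continuum_hypothesis"
  obtains r :: "real rel"
  where "Well_order r" "Field r = UNIV" "\<And>a. countable (under r a)"
proof
  let ?r = "card_of (UNIV :: real set)"
  show wo: "Well_order ?r" by (rule card_of_Well_order)
  show F: "Field ?r = UNIV" by (rule Field_card_of)
  fix a
  have "(card_of (underS ?r a), ?r) \<in> ordLess"
    using F by (intro card_of_underS card_of_Card_order) auto
  then have "\<not> (UNIV :: real set) \<lesssim> underS ?r a"
    unfolding lepoll_def using card_of_ordLess by blast
  then have small: "underS ?r a \<prec> (UNIV :: real set)"
    by (meson eqpoll_imp_lepoll eqpoll_sym lesspoll_def subset_UNIV subset_imp_lepoll)
  have "countable (underS ?r a)"
  proof (rule ccontr)
    assume unc: "uncountable (underS ?r a)"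
    then have "(UNIV :: nat set) \<lesssim> underS ?r a"
      using infinite_le_lepoll uncountable_infinite by blast
    moreover have "\<not> (UNIV :: nat set) \<approx> underS ?r a"
      using unc countable_eqpoll[OF countableI_type eqpoll_sym] by blast
    ultimately have "(UNIV :: nat set) \<prec> underS ?r a" by (simp add: lesspoll_def)
    with small assms show False unfolding continuum_hypothesis_def by blast
  qed
  moreover have "under ?r a \<subseteq> insert a (underS ?r a)"
    by (auto simp: under_def underS_def)
  ultimately show "countable (under ?r a)"
    by (meson countable_insert countable_subset)
qed

theorem erdos_kakutani:
  assumes "continuum_hypothesis"
  obtains D :: "nat \<Rightarrow> real set"
  where "\<And>n. rat_real.independent (D n)" "(\<Union>n. D n) = - {0}"
proof -
  obtain r :: "real rel" where r: "Well_order r" "Field r = UNIV"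
    and countable: "\<And>a. countable (under r a)"
    using continuum_hypothesis_well_order[OF assms] by metis
  obtain level where level: "\<And>x. x \<noteq> 0 \<Longrightarrow> x \<in> rat_real.span (under r (level x))
                                        \<and> x \<notin> rat_real.span (underS r (level x))"
    using level_exists[OF r] by metis
  define index where "index x = to_nat_on (rat_real.span (under r (level x))) x" for x
  define D where "D n = {x. x \<noteq> 0 \<and> index x = n}" for n
  have "inj_on level (D n)" for n
  proof (rule inj_onI)
    fix x y assume xy: "x \<in> D n" "y \<in> D n" "level x = level y"
    let ?S = "rat_real.span (under r (level x))"
    have "inj_on (to_nat_on ?S) ?S"
      by (intro inj_on_to_nat_on countable_rat_span countable)
    moreover have "x \<in> ?S" "y \<in> ?S" using xy level[of x] level[of y] by (auto simp: D_def)
    moreover have "to_nat_on ?S x = to_nat_on ?S y"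
      using xy by (simp add: D_def index_def)
    ultimately show "x = y" by (auto dest: inj_onD)
  qed
  then have "rat_real.independent (D n)" for n
    using level by (intro independent_if_distinct_levels[OF r, where level = level]) (auto simp: D_def)
  moreover have "(\<Union>n. D n) = - {0}" by (auto simp: D_def)
  ultimately show ?thesis by (rule that)
qed

section \<open>Independent sets are closed and discrete\<close>

lemma openin_tau_H_vimage:
  assumes "Modules.additive (H :: real \<Rightarrow> real)" "open V"
  shows "openin tau_H (H -` V)"
  unfolding tau_H_def using assms by (intro topology_generated_by_Basis) blast

lemma independent_extend_additive:
  assumes "rat_real.independent B"
  shows "\<exists>H :: real \<Rightarrow> real. Modules.additive H \<and> (\<forall>x\<in>B. H x = f x)"
proof -
  obtain H where "Vector_Spaces.linear (\<lambda>q x. real_of_rat q * x) (\<lambda>q x. real_of_rat q * x) H"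
    and "\<forall>x\<in>B. H x = f x"
    using rat_real_pair.linear_independent_extend[OF assms] by blast
  then show ?thesis
    by (intro exI[of _ H]) (auto simp: Modules.additive_def rat_real_pair.linear_add)
qed

text \<open>The identity is additive, so the topology refines the usual one and points are closed.\<close>

lemma openin_tau_H_Compl_singleton: "openin tau_H (- {x})"
  using openin_tau_H_vimage[of "\<lambda>x. x" "- {x}"]
  by (simp add: Modules.additive_def open_Compl)

lemma closedin_tau_H_subset_independent:
  assumes ind: "rat_real.independent D" and "C \<subseteq> D"
  shows "closedin tau_H C"
proof -
  have "\<exists>U. openin tau_H U \<and> p \<in> U \<and> U \<subseteq> - C" if "p \<notin> C" for p
  proof (cases "p = 0")
    case True
    obtain H :: "real \<Rightarrow> real" where H: "Modules.additive H" "\<forall>x\<in>D. H x = 1"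
      using independent_extend_additive[OF ind, of "\<lambda>_. 1"] by blast
    have "openin tau_H (H -` {..<1})" by (intro openin_tau_H_vimage H) auto
    moreover have "H 0 = 0" by (rule additive.zero[OF H(1)])
    ultimately show ?thesis
      using True H(2) \<open>C \<subseteq> D\<close> by (intro exI[of _ "H -` {..<1}"]) auto
  next
    case False
    then obtain d where d: "p \<notin> rat_real.span (D - {d})"
      using independent_remove_notin_span[OF ind] by blast
    have "rat_real.independent (insert p (D - {d}))"
      using d rat_real.dependent_mono[of "D - {d}" D] ind
      by (intro rat_real.independent_insertI) auto
    from independent_extend_additive[OF this, of "\<lambda>x. if x = p then 1 else 0"]
    obtain H :: "real \<Rightarrow> real" where H: "Modules.additive H"
      "\<forall>x\<in>insert p (D - {d}). H x = (if x = p then 1 else 0)"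
      by (elim exE conjE)
    have notin: "p \<notin> D - {d}" using d rat_real.span_base[of p "D - {d}"] by blast
    (* This open neighbourhood of p meets D at most in d. *)
    have U: "openin tau_H (H -` {0<..})" by (intro openin_tau_H_vimage H) auto
    have p: "p \<in> H -` {0<..}" using H(2) by simp
    have zero: "H x = 0" if "x \<in> D - {d}" for x
    proof -
      have "x \<noteq> p" using that notin by blast
      then show ?thesis using that H(2) by simp
    qed
    have D_d: "H -` {0<..} \<inter> D \<subseteq> {d}"
    proof
      fix x assume "x \<in> H -` {0<..} \<inter> D"
      then show "x \<in> {d}" using zero[of x] by (cases "x = d") auto
    qed
    show ?thesis
    proof (cases "p = d")
      case True
      then show ?thesis
        using U p D_d \<open>C \<subseteq> D\<close> \<open>p \<notin> C\<close> by (intro exI[of _ "H -` {0<..}"]) auto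
    next
      case False
      have "openin tau_H (H -` {0<..} \<inter> - {d})"
        by (intro openin_Int U openin_tau_H_Compl_singleton)
      then show ?thesis
        using False p D_d \<open>C \<subseteq> D\<close> by (intro exI[of _ "H -` {0<..} \<inter> - {d}"]) auto
    qed
  qed
  then have "openin tau_H (- C)"
    by (auto simp: openin_subopen[of tau_H "- C"])
  then show ?thesis by (simp add: closedin_def Compl_eq_Diff_UNIV)
qed

section \<open>Comparison of the two topologies\<close>

lemma openin_tau_Q_if_openin_tau_H:
  assumes "openin tau_H U"
  shows "openin tau_Q U"
proof (rule tau_H_smallest[OF topspace_tau_Q _ assms])
  fix H :: "real \<Rightarrow> real"
  assume H: "Modules.additive H"
  have lin: "H (a + q * x) = H a + q * H x" if "q \<in> \<rat>" for a q x
  proof -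
    interpret H: additive H by (rule H)
    have nat: "H (of_nat n * y) = of_nat n * H y" for n y
      by (induction n) (simp_all add: H.zero H.add algebra_simps)
    have int: "H (of_int i * y) = of_int i * H y" for i y
      using nat[of "nat \<bar>i\<bar>" y] H.minus[of "of_nat (nat \<bar>i\<bar>) * y"]
      by (cases "i \<ge> 0") auto
    obtain m n :: int where "n > 0" and q: "q = of_int m / of_int n"
      using Rats_cases'[OF \<open>q \<in> \<rat>\<close>] by blast
    then have "of_int n * H (q * x) = of_int m * H x"
      using int[of n "q * x"] int[of m x] by simp
    then have "H (q * x) = q * H x" using \<open>n > 0\<close> by (simp add: q field_simps)
    then show ?thesis by (simp add: H.add)
  qed
  have "openin tau_Q (H -` V)" if "open V" for V
    unfolding openin_tau_Q tau_Q_open_def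
  proof (intro ballI allI impI)
    fix a x :: real assume "a \<in> H -` V" "x \<noteq> 0"
    have "((\<lambda>t. H a + t * H x) \<longlongrightarrow> H a + 0 * H x) (at_right 0)"
      by (intro tendsto_intros)
    then have "eventually (\<lambda>t. H a + t * H x \<in> V) (at_right 0)"
      using \<open>open V\<close> \<open>a \<in> H -` V\<close> by (auto dest: topological_tendstoD)
    then obtain \<epsilon> where "\<epsilon> > 0" "\<And>t. 0 < t \<Longrightarrow> t < \<epsilon> \<Longrightarrow> H a + t * H x \<in> V"
      unfolding eventually_at_right_field by blast
    then show "\<exists>\<epsilon>>0. \<forall>q\<in>\<rat>. 0 < q \<and> q < \<epsilon> \<longrightarrow> a + q * x \<in> H -` V"
      using lin by (intro exI[of _ \<epsilon>]) auto
  qed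
  then show "continuous_map tau_Q euclidean H"
    by (simp add: continuous_map_def vimage_def)
qed

theorem theorem7p11:
  assumes "continuum_hypothesis"
  shows "(\<forall>A :: real set. fsigma_in tau_Q A) \<and> (\<forall>A :: real set. fsigma_in tau_H A)"
proof -
  obtain D :: "nat \<Rightarrow> real set"
    where D: "\<And>n. rat_real.independent (D n)" "(\<Union>n. D n) = - {0}"
    using erdos_kakutani[OF assms] by metis
  have closed_Q: "closedin tau_Q C" if "closedin tau_H C" for C
    using that openin_tau_Q_if_openin_tau_H by (simp add: closedin_def)
  have split: "A = \<Union> (insert (A \<inter> {0}) (range (\<lambda>n. A \<inter> D n)))" for A
    using D(2) by auto
  have zero: "closedin tau_H {0}"
    using openin_tau_H_Compl_singleton[of 0] by (simp add: closedin_def Compl_eq_Diff_UNIV)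
  have closed: "closedin tau_H C" if "C \<in> insert (A \<inter> {0}) (range (\<lambda>n. A \<inter> D n))" for A C
    using that closedin_tau_H_subset_independent[OF D(1) Int_lower2] zero
    by (cases "0 \<in> A") auto
  have "fsigma_in X A"
    if X: "\<And>C. closedin tau_H C \<Longrightarrow> closedin X C" for X and A :: "real set"
    by (subst split, rule fsigma_in_Union) (use closed in \<open>auto intro!: closed_imp_fsigma_in X\<close>)
  then show ?thesis using closed_Q by blast
qed

end
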